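(* For all integers $n \ge 2$ and all integers $v$ with $1 \le v \le \pi(n)$, one has $C_{n,v} = \Phi(n,p_v)$, the number of integers in $[1,n]$ having no prime factor $\le p_v$.
   Context: $p_1=2<p_2=3<\cdots$ are the primes and $\pi(x)$ is the number of primes $\le x$. $K$ is a field containing $\mathbb{Q}$. For a positive integer $n$ put $r=\pi(n)$ and $S=K[x_1,\dots,x_r]$. The weight of a monomial $m=x_1^{a_1}\cdots x_r^{a_r}$ is $w(m)=\prod_i p_i^{a_i}$. $I_n\subset S$ is the monomial ideal generated by all monomials of weight $>n$, and $G(I_n)$ is its minimal monomial generating set. For a monomial $m\ne 1$, $\min(m)$ is the least index $i$ with $a_i>0$. Define $C_{n,v}=\#\{m\in G(I_n):\min(m)=v\}$. Legendre's sifting function is $\Phi(x,y)=\#\{m\in\mathbb{Z}_{\ge1}: m\le x,\ \text{every prime } p\mid m \text{ satisfies } p>y\}$ (the integer $1$ is counted when $x\ge 1$). *)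

theory Defs
  imports Complex_Main "HOL-Library.Poly_Mapping" "HOL-Library.Infinite_Set"
    "HOL-Computational_Algebra.Primes" "HOL-Algebra.Ideal"
begin

text \<open>The enumeration is 1-based, as in \<open>p\<^sub>1 = 2, p\<^sub>2 = 3, \<dots>\<close>; the value at 0 is never used.\<close>

definition nth_prime :: "nat \<Rightarrow> nat" where
  "nth_prime i = enumerate {p. prime p} (i - 1)"

definition prime_count :: "real \<Rightarrow> nat" where
  "prime_count x = card {p::nat. prime p \<and> real p \<le> x}"

definition legendre_phi :: "real \<Rightarrow> real \<Rightarrow> nat" where
  "legendre_phi x y =
     card {m::nat. 1 \<le> m \<and> real m \<le> x \<and> (\<forall>p. prime p \<and> p dvd m \<longrightarrow> real p > y)}"

text \<open>
  A monomial is represented by its finitely supported exponent vector \<open>a\<close>, where \<open>lookup a i\<close> is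
  the exponent of the variable \<open>x\<^sub>i\<close>; the monomial 1 is the vector 0. Polynomials are finitely
  supported functions from exponent vectors to coefficients, and \<open>K[x\<^sub>1,\<dots>,x\<^sub>r]\<close> is the
  subring of those polynomials in which only variables with index in \<open>{1..r}\<close> occur.
\<close>

type_synonym monomial = "nat \<Rightarrow>\<^sub>0 nat"

definition monomials :: "nat \<Rightarrow> monomial set" where
  "monomials r = {a. Poly_Mapping.keys a \<subseteq> {1..r}}"

definition mon_poly :: "monomial \<Rightarrow> (monomial \<Rightarrow>\<^sub>0 'k::field_char_0)" where
  "mon_poly a = Poly_Mapping.single a 1"

definition poly_ring :: "nat \<Rightarrow> (monomial \<Rightarrow>\<^sub>0 'k::field_char_0) ring" where
  "poly_ring r =
     \<lparr>carrier = {f. Poly_Mapping.keys f \<subseteq> monomials r},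
      monoid.mult = (*), one = 1, zero = 0, add = (+)\<rparr>"

lemma monomials_0: "0 \<in> monomials r"
  by (simp add: monomials_def)

lemma monomials_add: "a \<in> monomials r \<Longrightarrow> b \<in> monomials r \<Longrightarrow> a + b \<in> monomials r"
  using Poly_Mapping.keys_add[of a b] by (auto simp: monomials_def)

lemma poly_ring_cring: "cring (poly_ring r :: (monomial \<Rightarrow>\<^sub>0 'k::field_char_0) ring)"
proof (rule cringI)
  let ?R = "poly_ring r :: (monomial \<Rightarrow>\<^sub>0 'k) ring"
  show "abelian_group ?R"
  proof (rule abelian_groupI)
    fix f g assume "f \<in> carrier ?R" "g \<in> carrier ?R"
    then show "f \<oplus>\<^bsub>?R\<^esub> g \<in> carrier ?R"
      using Poly_Mapping.keys_add[of f g] by (auto simp: poly_ring_def)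
  next
    fix f assume f: "f \<in> carrier ?R"
    then have "- f \<in> carrier ?R" "- f \<oplus>\<^bsub>?R\<^esub> f = \<zero>\<^bsub>?R\<^esub>"
      by (auto simp: poly_ring_def)
    then show "\<exists>g\<in>carrier ?R. g \<oplus>\<^bsub>?R\<^esub> f = \<zero>\<^bsub>?R\<^esub>" by blast
  qed (auto simp: poly_ring_def add_ac)
next
  let ?R = "poly_ring r :: (monomial \<Rightarrow>\<^sub>0 'k) ring"
  show "comm_monoid ?R"
  proof (rule comm_monoidI)
    fix f g assume "f \<in> carrier ?R" "g \<in> carrier ?R"
    then show "f \<otimes>\<^bsub>?R\<^esub> g \<in> carrier ?R"
      using Poly_Mapping.keys_mult[of f g] monomials_add by (fastforce simp: poly_ring_def)
  qed (auto simp: poly_ring_def mult_ac monomials_0)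
qed (auto simp: poly_ring_def algebra_simps)

definition weight :: "monomial \<Rightarrow> nat" where
  "weight a = (\<Prod>i\<in>Poly_Mapping.keys a. nth_prime i ^ Poly_Mapping.lookup a i)"

definition weight_ideal :: "nat \<Rightarrow> (monomial \<Rightarrow>\<^sub>0 'k::field_char_0) set" where
  "weight_ideal n =
     (let r = prime_count (real n)
      in Idl\<^bsub>poly_ring r\<^esub> (mon_poly ` {a \<in> monomials r. weight a > n}))"

definition is_min_mon_gens ::
    "nat \<Rightarrow> (monomial \<Rightarrow>\<^sub>0 'k::field_char_0) set \<Rightarrow> monomial set \<Rightarrow> bool" where
  "is_min_mon_gens r I A \<longleftrightarrow>
     A \<subseteq> monomials r \<and> Idl\<^bsub>poly_ring r\<^esub> (mon_poly ` A) = I \<and>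
     (\<forall>B. B \<subset> A \<longrightarrow> Idl\<^bsub>poly_ring r\<^esub> (mon_poly ` B) \<noteq> I)"

definition min_mon_gens :: "nat \<Rightarrow> (monomial \<Rightarrow>\<^sub>0 'k::field_char_0) set \<Rightarrow> monomial set" where
  "min_mon_gens r I = (THE A. is_min_mon_gens r I A)"

definition min_index :: "monomial \<Rightarrow> nat" where
  "min_index a = (LEAST i. Poly_Mapping.lookup a i > 0)"

text \<open>
  The coefficient field is passed as a type argument. The condition \<open>a \<noteq> 0\<close> excludes the
  monomial 1, for which \<open>min_index\<close> is unspecified.
\<close>

definition gens_count :: "'k::field_char_0 itself \<Rightarrow> nat \<Rightarrow> nat \<Rightarrow> nat" where
  "gens_count _ n v =
     card {a \<in> min_mon_gens (prime_count (real n))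
                 (weight_ideal n :: (monomial \<Rightarrow>\<^sub>0 'k) set).
             a \<noteq> 0 \<and> min_index a = v}"

end

(*
  A monomial lies in the ideal generated by a set of monomials iff one of them divides it, so
  G(I_n) consists of the divisibility-minimal monomials of weight > n. Deleting the variable x_v
  from such a monomial with least index v leaves a monomial of weight at most n whose prime
  factors all exceed p_v. Conversely, for an integer k <= n with all prime factors > p_v there is
  exactly one exponent e with k p_v^(e-1) <= n < k p_v^e, and k p_v^e is the weight of a
  minimal generator because dividing by any of its primes divides it by at least p_v.
*)
theory Submission
  imports Defs
begin

section \<open>Primes\<close>

lemma infinite_primes: "infinite {p::nat. prime p}"
  using primes_infinite by simp

lemma prime_nth_prime: "prime (nth_prime i)"
  unfolding nth_prime_def using enumerate_in_set[OF infinite_primes] by blast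

lemma nth_prime_pos [simp]: "nth_prime i > 0" and nth_prime_nonzero [simp]: "nth_prime i \<noteq> 0"
  using prime_gt_0_nat[OF prime_nth_prime, of i] by simp_all

lemma nth_prime_less: "1 \<le> i \<Longrightarrow> i < j \<Longrightarrow> nth_prime i < nth_prime j"
  unfolding nth_prime_def by (rule enumerate_mono[OF _ infinite_primes]) auto

lemma nth_prime_le: "1 \<le> i \<Longrightarrow> i \<le> j \<Longrightarrow> nth_prime i \<le> nth_prime j"
  using nth_prime_less[of i j] by (cases "i = j") auto

text \<open>Index 0 is left out because truncated subtraction gives
  \<open>nth_prime 0 = nth_prime 1\<close>.\<close>

lemma inj_on_nth_prime: "inj_on nth_prime {1..}"
  by (rule linorder_inj_onI) (metis atLeast_iff less_irrefl nth_prime_less, rule linear)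

text \<open>Provides a variable of the ring for each prime up to \<open>n\<close>. If
  \<open>p\<close> has index \<open>Suc j\<close>, the primes with indices 1 to \<open>Suc j\<close>
  are distinct and at most \<open>n\<close>, so \<open>Suc j\<close> is at most the number of primes
  up to \<open>n\<close>.\<close>

lemma ex_nth_prime:
  assumes "prime p" "p \<le> n"
  obtains i where "i \<in> {1..prime_count (real n)}" "nth_prime i = p"
proof -
  obtain j where j: "enumerate {p. prime p} j = p"
    using range_enumerate[OF infinite_primes] assms(1) by (metis imageE mem_Collect_eq)
  then have p: "nth_prime (Suc j) = p"
    by (simp add: nth_prime_def)
  have "card (nth_prime ` {1..Suc j}) \<le> card {q. prime q \<and> real q \<le> real n}"
  proof (rule card_mono)
    show "finite {q. prime q \<and> real q \<le> real n}"
      by (rule finite_subset[of _ "{..n}"]) auto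
    show "nth_prime ` {1..Suc j} \<subseteq> {q. prime q \<and> real q \<le> real n}"
      using nth_prime_le[of _ "Suc j"] p assms(2) prime_nth_prime by fastforce
  qed
  moreover have "card (nth_prime ` {1..Suc j}) = Suc j"
    by (subst card_image) (auto intro: inj_on_subset[OF inj_on_nth_prime])
  ultimately show thesis
    using that[of "Suc j"] p by (simp add: prime_count_def)
qed

section \<open>Weights\<close>

text \<open>Indices outside the support contribute a factor with exponent 0; a common index set lets
  weights be multiplied factor by factor.\<close>

lemma weight_superset:
  assumes "finite A" "Poly_Mapping.keys a \<subseteq> A"
  shows "weight a = (\<Prod>i\<in>A. nth_prime i ^ Poly_Mapping.lookup a i)"
  unfolding weight_def
  by (rule prod.mono_neutral_left) (use assms in \<open>auto simp: in_keys_iff\<close>)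

lemma weight_0 [simp]: "weight 0 = 1"
  by (simp add: weight_def)

lemma weight_add: "weight (a + b) = weight a * weight b"
proof -
  let ?A = "Poly_Mapping.keys a \<union> Poly_Mapping.keys b"
  have "weight (a + b) = (\<Prod>i\<in>?A. nth_prime i ^ Poly_Mapping.lookup (a + b) i)"
    by (rule weight_superset) (use Poly_Mapping.keys_add[of a b] in auto)
  also have "\<dots> = weight a * weight b"
    by (simp add: weight_superset[of ?A] lookup_add power_add prod.distrib)
  finally show ?thesis .
qed

lemma weight_single: "weight (Poly_Mapping.single i e) = nth_prime i ^ e"
  by (subst weight_superset[of "{i}"]) auto

lemma weight_pos: "weight a > 0"
  unfolding weight_def by (intro prod_pos) simp

lemma prime_dvd_weight:
  assumes "prime p" "p dvd weight a"
  obtains i where "i \<in> Poly_Mapping.keys a" "p = nth_prime i"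
proof -
  obtain i where i: "i \<in> Poly_Mapping.keys a" "p dvd nth_prime i ^ Poly_Mapping.lookup a i"
    using assms unfolding weight_def by (auto simp: prime_dvd_prod_iff)
  then have "p dvd nth_prime i"
    using assms(1) prime_dvd_power by blast
  then have "p = nth_prime i"
    using assms(1) prime_nth_prime primes_dvd_imp_eq by blast
  with i that show thesis by blast
qed

lemma nth_prime_dvd_weight: "i \<in> Poly_Mapping.keys a \<Longrightarrow> nth_prime i dvd weight a"
  unfolding weight_def
  by (rule dvd_trans[OF _ dvd_prodI]) (auto simp: in_keys_iff intro: dvd_power)

lemma weight_gt_1: "a \<noteq> 0 \<Longrightarrow> weight a > 1"
proof -
  assume "a \<noteq> 0"
  then obtain i where "i \<in> Poly_Mapping.keys a" by fastforce
  then have "nth_prime i \<le> weight a"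
    using nth_prime_dvd_weight weight_pos dvd_imp_le by blast
  then show ?thesis
    using prime_gt_1_nat[OF prime_nth_prime, of i] by simp
qed

text \<open>Primes with different positive indices differ, so only the factor \<open>j = i\<close>
  contributes to the valuation. For \<open>i\<close> outside the support both sides are 0.\<close>

lemma multiplicity_weight:
  assumes "a \<in> monomials r" "1 \<le> i"
  shows "multiplicity (nth_prime i) (weight a) = Poly_Mapping.lookup a i"
proof -
  have "multiplicity (nth_prime i) (weight a) =
      (\<Sum>j\<in>Poly_Mapping.keys a. multiplicity (nth_prime i) (nth_prime j ^ Poly_Mapping.lookup a j))"
    unfolding weight_def
    by (rule prime_elem_multiplicity_prod_distrib)
      (auto simp: prime_nth_prime)
  also have "\<dots> = (\<Sum>j\<in>Poly_Mapping.keys a. if j = i then Poly_Mapping.lookup a j else 0)"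
  proof (rule sum.cong)
    fix j assume "j \<in> Poly_Mapping.keys a"
    then have "1 \<le> j"
      using assms(1) by (auto simp: monomials_def)
    then have "nth_prime j \<noteq> nth_prime i" if "j \<noteq> i"
      using that assms(2) inj_on_nth_prime by (auto simp: inj_on_def)
    then show "multiplicity (nth_prime i) (nth_prime j ^ Poly_Mapping.lookup a j) =
        (if j = i then Poly_Mapping.lookup a j else 0)"
      by (auto simp: prime_nth_prime multiplicity_distinct_prime_power)
  qed simp
  also have "\<dots> = Poly_Mapping.lookup a i"
    by (simp add: in_keys_iff)
  finally show ?thesis .
qed

lemma inj_on_weight: "inj_on weight (monomials r)"
proof (rule inj_onI)
  fix a b assume ab: "a \<in> monomials r" "b \<in> monomials r" "weight a = weight b"
  show "a = b"
  proof (rule poly_mapping_eqI)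
    fix i
    have zero_notin: "0 \<notin> Poly_Mapping.keys c" if "c \<in> monomials r" for c
      using that by (auto simp: monomials_def simp del: in_keys_iff)
    show "Poly_Mapping.lookup a i = Poly_Mapping.lookup b i"
    \<comment> \<open>Valuations recover the exponents at positive indices only; at 0 both exponents
      vanish because no monomial of the ring involves \<open>x_0\<close>.\<close>
    proof (cases "i = 0")
      case True
      then show ?thesis
        using zero_notin ab by (simp add: in_keys_iff)
    next
      case False
      then show ?thesis
        using multiplicity_weight[OF ab(1), of i] multiplicity_weight[OF ab(2), of i] ab(3) by simp
    qed
  qed
qed

text \<open>The existence half of unique factorization, with \<open>inj_on_weight\<close> as the
  uniqueness half. The bound on prime factors passes from \<open>p * m\<close> to \<open>m\<close>
  and supplies the variable belonging to \<open>p\<close>.\<close>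

lemma ex_weight:
  fixes m :: nat
  assumes "m > 0" "\<And>p. prime p \<Longrightarrow> p dvd m \<Longrightarrow> p \<le> n"
  shows "\<exists>b\<in>monomials (prime_count (real n)). weight b = m"
  using assms
proof (induction m rule: prime_divisors_induct)
  case (unit m)
  then show ?case by (auto intro!: bexI[of _ 0] simp: monomials_0)
next
  case (factor p m)
  then obtain b where b: "b \<in> monomials (prime_count (real n))" "weight b = m"
    by force
  from factor have "p \<le> n" by simp
  with \<open>prime p\<close> obtain i where i: "i \<in> {1..prime_count (real n)}" "nth_prime i = p"
    by (rule ex_nth_prime)
  have "Poly_Mapping.single i 1 \<in> monomials (prime_count (real n))"
    using i by (auto simp: monomials_def)
  with b i show ?case
    by (intro bexI[of _ "Poly_Mapping.single i 1 + b"])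
      (auto simp: weight_add weight_single monomials_add)
qed simp

section \<open>Monomial ideals\<close>

lemma mon_poly_in_carrier:
  "a \<in> monomials r \<Longrightarrow> mon_poly a \<in> carrier (poly_ring r)"
  by (auto simp: poly_ring_def mon_poly_def)

lemma mon_poly_mult: "mon_poly (a + b) = mon_poly b * mon_poly a"
  by (simp add: mon_poly_def mult_single add.commute)

text \<open>Serves as an upper bound for the ideal generated by \<open>A\<close>, so that membership
  can be tested term by term. It absorbs products because every key of \<open>g * f\<close> is a key
  of \<open>g\<close> plus a key of \<open>f\<close>.\<close>

lemma ideal_divisible_keys:
  "ideal {f \<in> carrier (poly_ring r :: (monomial \<Rightarrow>\<^sub>0 'k::field_char_0) ring).
      \<forall>k\<in>Poly_Mapping.keys f. \<exists>b\<in>A. \<exists>c\<in>monomials r. k = b + c} (poly_ring r)"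
    (is "ideal ?J ?R")
proof -
  interpret cring ?R by (rule poly_ring_cring)
  have mult: "g * f \<in> ?J" if "f \<in> ?J" "g \<in> carrier ?R" for f g
  proof -
    have "g * f \<in> carrier ?R"
      using m_closed[of g f] that by (simp add: poly_ring_def)
    moreover have "\<exists>b\<in>A. \<exists>c\<in>monomials r. k = b + c" if k: "k \<in> Poly_Mapping.keys (g * f)" for k
    proof -
      obtain s t where st: "k = s + t" "s \<in> Poly_Mapping.keys g" "t \<in> Poly_Mapping.keys f"
        using Poly_Mapping.keys_mult[of g f] k by blast
      then obtain b c where "b \<in> A" "c \<in> monomials r" "t = b + c"
        using \<open>f \<in> ?J\<close> by blast
      moreover have "s \<in> monomials r"
        using \<open>g \<in> carrier ?R\<close> st by (auto simp: poly_ring_def)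
      ultimately show ?thesis
        using st by (intro bexI[of _ b] bexI[of _ "s + c"]) (auto simp: monomials_add add_ac)
    qed
    ultimately show ?thesis by blast
  qed
  show ?thesis
  proof (rule idealI)
    show "ring ?R" by (rule ring_axioms)
    show "subgroup ?J (add_monoid ?R)"
    proof (rule add.subgroupI)
      show "?J \<noteq> {}" by (auto simp: poly_ring_def intro!: exI[of _ 0])
      fix f assume f: "f \<in> ?J"
      \<comment> \<open>The ring's negative is given only abstractly; uniqueness of additive
        inverses identifies it with pointwise negation, which keeps the keys.\<close>
      have "- f \<in> carrier ?R" "- f \<oplus>\<^bsub>?R\<^esub> f = \<zero>\<^bsub>?R\<^esub>"
        using f by (auto simp: poly_ring_def)
      then have "\<ominus>\<^bsub>?R\<^esub> f = - f"
        using f by (intro minus_equality) auto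
      then show "\<ominus>\<^bsub>?R\<^esub> f \<in> ?J"
        using f by (auto simp: poly_ring_def)
      fix g assume g: "g \<in> ?J"
      then show "f \<oplus>\<^bsub>?R\<^esub> g \<in> ?J"
        using f Poly_Mapping.keys_add[of f g] by (auto simp: poly_ring_def)
    qed auto
  next
    fix f g assume fg: "f \<in> ?J" "g \<in> carrier ?R"
    show "g \<otimes>\<^bsub>?R\<^esub> f \<in> ?J"
      using mult[OF fg] by (simp add: poly_ring_def)
    show "f \<otimes>\<^bsub>?R\<^esub> g \<in> ?J"
      using mult[OF fg] by (simp add: poly_ring_def mult.commute)
  qed
qed

text \<open>Since \<open>mon_poly a\<close> has the single key \<open>a\<close>, the bound from
  \<open>ideal_divisible_keys\<close> yields a generator dividing \<open>a\<close>. Conversely,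
  ideals absorb multiplication by the cofactor \<open>c\<close>.\<close>

lemma mon_poly_in_Idl_iff:
  assumes A: "A \<subseteq> monomials r" and a: "a \<in> monomials r"
  shows "(mon_poly a :: monomial \<Rightarrow>\<^sub>0 'k::field_char_0) \<in> Idl\<^bsub>poly_ring r\<^esub> (mon_poly ` A) \<longleftrightarrow>
    (\<exists>b\<in>A. \<exists>c\<in>monomials r. a = b + c)"
proof -
  let ?R = "poly_ring r :: (monomial \<Rightarrow>\<^sub>0 'k) ring"
  interpret cring ?R by (rule poly_ring_cring)
  have sub: "mon_poly ` A \<subseteq> carrier ?R"
    using A mon_poly_in_carrier by blast
  show ?thesis
  proof
    assume "(mon_poly a :: monomial \<Rightarrow>\<^sub>0 'k) \<in> Idl\<^bsub>?R\<^esub> (mon_poly ` A)"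
    moreover have "Idl\<^bsub>?R\<^esub> (mon_poly ` A) \<subseteq> {f \<in> carrier ?R.
        \<forall>k\<in>Poly_Mapping.keys f. \<exists>b\<in>A. \<exists>c\<in>monomials r. k = b + c}"
    proof (rule genideal_minimal[OF ideal_divisible_keys], rule image_subsetI)
      fix b assume b: "b \<in> A"
      have "\<exists>b'\<in>A. \<exists>c\<in>monomials r. b = b' + c"
        using b by (intro bexI[of _ b] bexI[of _ 0]) (auto simp: monomials_0)
      then show "mon_poly b \<in> {f \<in> carrier ?R.
          \<forall>k\<in>Poly_Mapping.keys f. \<exists>b\<in>A. \<exists>c\<in>monomials r. k = b + c}"
        using b A by (auto simp: mon_poly_def poly_ring_def)
    qed
    ultimately show "\<exists>b\<in>A. \<exists>c\<in>monomials r. a = b + c"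
      by (auto simp: mon_poly_def)
  next
    assume "\<exists>b\<in>A. \<exists>c\<in>monomials r. a = b + c"
    then obtain b c where bc: "b \<in> A" "c \<in> monomials r" "a = b + c" by blast
    interpret I: ideal "Idl\<^bsub>?R\<^esub> (mon_poly ` A)" ?R
      by (rule genideal_ideal[OF sub])
    have "mon_poly c \<otimes>\<^bsub>?R\<^esub> mon_poly b \<in> Idl\<^bsub>?R\<^esub> (mon_poly ` A)"
      using bc genideal_self[OF sub] mon_poly_in_carrier by (intro I.I_l_closed) auto
    then show "(mon_poly a :: monomial \<Rightarrow>\<^sub>0 'k) \<in> Idl\<^bsub>?R\<^esub> (mon_poly ` A)"
      by (simp add: bc mon_poly_mult poly_ring_def)
  qed
qed

section \<open>Divisibility-minimal monomials as minimal generators\<close>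

definition minimal_monomials :: "nat \<Rightarrow> monomial set \<Rightarrow> monomial set" where
  "minimal_monomials r W = {a \<in> W. \<forall>b\<in>W. \<forall>c\<in>monomials r. a = b + c \<longrightarrow> c = 0}"

text \<open>Descent on the weight: a nontrivial cofactor has weight greater than 1, so a non-minimal
  element has a lighter divisor in \<open>W\<close>.\<close>

lemma minimal_monomials_divides:
  assumes "W \<subseteq> monomials r" "a \<in> W"
  shows "\<exists>b\<in>minimal_monomials r W. \<exists>c\<in>monomials r. a = b + c"
  using assms(2)
proof (induction "weight a" arbitrary: a rule: less_induct)
  case less
  show ?case
  proof (cases "a \<in> minimal_monomials r W")
    case True
    then show ?thesis using monomials_0 by (metis add.right_neutral)
  next
    case False
    then obtain b c where bc: "b \<in> W" "c \<in> monomials r" "a = b + c" "c \<noteq> 0"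
      using less.prems by (auto simp: minimal_monomials_def)
    then have "weight b < weight a"
      using weight_gt_1[of c] weight_pos[of b] by (simp add: weight_add)
    then obtain b' c' where "b' \<in> minimal_monomials r W" "c' \<in> monomials r" "b = b' + c'"
      using less.hyps bc by blast
    then show ?thesis
      using bc by (metis add.assoc monomials_add)
  qed
qed

text \<open>The minimal elements generate the ideal and lie in every monomial generating set. A
  least generating set is the only one that is minimal for inclusion.\<close>

lemma min_mon_gens_Idl:
  assumes W: "W \<subseteq> monomials r"
    and up: "\<And>a c. a \<in> W \<Longrightarrow> c \<in> monomials r \<Longrightarrow> a + c \<in> W"
  shows "min_mon_gens r (Idl\<^bsub>poly_ring r\<^esub> (mon_poly ` W) :: (monomial \<Rightarrow>\<^sub>0 'k::field_char_0) set)
    = minimal_monomials r W"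
proof -
  let ?R = "poly_ring r :: (monomial \<Rightarrow>\<^sub>0 'k) ring"
  let ?I = "Idl\<^bsub>?R\<^esub> (mon_poly ` W)" and ?M = "minimal_monomials r W"
  interpret cring ?R by (rule poly_ring_cring)
  have MW: "?M \<subseteq> W" by (auto simp: minimal_monomials_def)
  have carr: "mon_poly ` B \<subseteq> carrier ?R" if "B \<subseteq> monomials r" for B
    using that mon_poly_in_carrier by blast
  have IM: "Idl\<^bsub>?R\<^esub> (mon_poly ` ?M) = ?I"
  proof
    have "mon_poly ` ?M \<subseteq> ?I"
      using genideal_self[OF carr[OF W]] MW by blast
    then show "Idl\<^bsub>?R\<^esub> (mon_poly ` ?M) \<subseteq> ?I"
      by (rule genideal_minimal[OF genideal_ideal[OF carr[OF W]]])
    have "mon_poly ` W \<subseteq> Idl\<^bsub>?R\<^esub> (mon_poly ` ?M)"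
    proof (rule image_subsetI)
      fix a assume "a \<in> W"
      then show "(mon_poly a :: monomial \<Rightarrow>\<^sub>0 'k) \<in> Idl\<^bsub>?R\<^esub> (mon_poly ` ?M)"
        using minimal_monomials_divides[OF W] MW W by (subst mon_poly_in_Idl_iff) auto
    qed
    then show "?I \<subseteq> Idl\<^bsub>?R\<^esub> (mon_poly ` ?M)"
      using MW W by (intro genideal_minimal genideal_ideal carr) auto
  qed
  \<comment> \<open>Some \<open>b\<close> in \<open>A\<close> divides \<open>a\<close>. By
    \<open>up\<close>, every monomial of the ideal from the ring is in \<open>W\<close>, so
    \<open>b\<close> is in \<open>W\<close> and minimality of \<open>a\<close> forces
    \<open>b = a\<close>.\<close>
  have sub: "?M \<subseteq> A" if A: "A \<subseteq> monomials r" "Idl\<^bsub>?R\<^esub> (mon_poly ` A) = ?I" for A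
  proof
    fix a assume a: "a \<in> ?M"
    then have "(mon_poly a :: monomial \<Rightarrow>\<^sub>0 'k) \<in> Idl\<^bsub>?R\<^esub> (mon_poly ` A)"
      using A MW genideal_self[OF carr[OF W]] by blast
    then obtain b c where bc: "b \<in> A" "c \<in> monomials r" "a = b + c"
      using mon_poly_in_Idl_iff[OF A(1), of a] a MW W by blast
    have "(mon_poly b :: monomial \<Rightarrow>\<^sub>0 'k) \<in> ?I"
      using genideal_self[OF carr[OF A(1)]] A(2) bc by blast
    then have "b \<in> W"
      using mon_poly_in_Idl_iff[OF W, of b] up A(1) bc by blast
    then have "c = 0"
      using a bc by (auto simp: minimal_monomials_def)
    then show "a \<in> A" using bc by simp
  qed
  show ?thesis
    unfolding min_mon_gens_def
  proof (rule the_equality)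
    show "is_min_mon_gens r ?I ?M"
      unfolding is_min_mon_gens_def using IM MW W sub by (metis psubset_imp_subset psubsetE subset_trans)
    show "A = ?M" if "is_min_mon_gens r ?I A" for A
      using that sub IM unfolding is_min_mon_gens_def by (metis psubsetI)
  qed
qed

lemma min_mon_gens_weight_ideal:
  fixes n :: nat
  defines "r \<equiv> prime_count (real n)"
  shows "min_mon_gens r (weight_ideal n :: (monomial \<Rightarrow>\<^sub>0 'k::field_char_0) set)
    = minimal_monomials r {a \<in> monomials r. weight a > n}"
proof -
  have "weight (a + c) > n" if "weight a > n" for a c
    using that weight_pos[of c] by (simp add: weight_add less_le_trans)
  then show ?thesis
    unfolding weight_ideal_def Let_def r_def
    by (intro min_mon_gens_Idl) (auto simp: monomials_add)
qed

section \<open>Removing the least variable\<close>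

lemma min_index_eq_iff:
  assumes "a \<noteq> 0"
  shows "min_index a = v \<longleftrightarrow> v \<in> Poly_Mapping.keys a \<and> Poly_Mapping.keys a \<subseteq> {v..}"
proof
  obtain i where "Poly_Mapping.lookup a i > 0"
    using assms by (metis gr0I lookup_zero poly_mapping_eqI)
  then show "v \<in> Poly_Mapping.keys a \<and> Poly_Mapping.keys a \<subseteq> {v..}" if "min_index a = v"
    using that LeastI[of "\<lambda>i. Poly_Mapping.lookup a i > 0"]
      Least_le[of "\<lambda>i. Poly_Mapping.lookup a i > 0"]
    by (auto simp: min_index_def in_keys_iff)
  show "min_index a = v" if "v \<in> Poly_Mapping.keys a \<and> Poly_Mapping.keys a \<subseteq> {v..}"
    unfolding min_index_def using that by (intro Least_equality) (auto simp: in_keys_iff subset_iff)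
qed

lemma update_zero_add_single:
  fixes a :: monomial
  shows "Poly_Mapping.update v 0 a + Poly_Mapping.single v (Poly_Mapping.lookup a v) = a"
  by (rule poly_mapping_eqI) (auto simp: lookup_add lookup_update lookup_single when_def)

lemma keys_update_zero: "Poly_Mapping.keys (Poly_Mapping.update v 0 a) = Poly_Mapping.keys a - {v}"
  by (auto simp: in_keys_iff lookup_update split: if_splits)

text \<open>Monomials that agree away from \<open>x_v\<close> are comparable for divisibility,
  whereas distinct minimal elements are not.\<close>

lemma inj_on_update_minimal_monomials:
  assumes "1 \<le> v" "v \<le> r"
  shows "inj_on (Poly_Mapping.update v 0) (minimal_monomials r W)"
proof (rule inj_onI)
  have le: "Poly_Mapping.lookup a v \<le> Poly_Mapping.lookup b v"
    if "a \<in> minimal_monomials r W" "b \<in> W"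
      and eq: "Poly_Mapping.update v 0 a = Poly_Mapping.update v 0 b" for a b
  proof (rule ccontr)
    assume "\<not> Poly_Mapping.lookup a v \<le> Poly_Mapping.lookup b v"
    then obtain d where d: "Poly_Mapping.lookup a v = Poly_Mapping.lookup b v + d" "d > 0"
      by (metis le_add1 less_imp_add_positive not_le)
    have "a = Poly_Mapping.update v 0 b + Poly_Mapping.single v (Poly_Mapping.lookup b v)
        + Poly_Mapping.single v d"
      using update_zero_add_single[of v a] eq d by (simp add: single_add add.assoc)
    then have "a = b + Poly_Mapping.single v d"
      by (simp only: update_zero_add_single)
    moreover have "Poly_Mapping.single v d \<in> monomials r"
      using assms by (auto simp: monomials_def)
    ultimately have "Poly_Mapping.single v d = 0"
      using that by (auto simp: minimal_monomials_def)
    with d show False by (metis lookup_single_eq lookup_zero less_irrefl)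
  qed
  fix a b
  assume ab: "a \<in> minimal_monomials r W" "b \<in> minimal_monomials r W"
    and eq: "Poly_Mapping.update v 0 a = Poly_Mapping.update v 0 b"
  then have lookup_eq: "Poly_Mapping.lookup a v = Poly_Mapping.lookup b v"
    using le[of a b] le[of b a] by (auto simp: minimal_monomials_def)
  have "a = Poly_Mapping.update v 0 a + Poly_Mapping.single v (Poly_Mapping.lookup a v)"
    by (rule update_zero_add_single[symmetric])
  also have "\<dots> = b"
    unfolding eq lookup_eq by (rule update_zero_add_single)
  finally show "a = b" .
qed

text \<open>\<open>Suc e\<close> is the least exponent at which the product exceeds
  \<open>n\<close>. It exists because \<open>n < p ^ n\<close>, and it is positive because
  \<open>k \<le> n\<close>.\<close>

lemma minimal_exponent:
  fixes k n p :: nat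
  assumes "0 < k" "k \<le> n" "1 < p"
  obtains e where "k * p ^ e \<le> n" "n < k * p ^ Suc e"
proof -
  have "n < p ^ n" using assms(3) by (simp add: power_gt_expt)
  also have "\<dots> \<le> k * p ^ n" using assms(1) by simp
  finally have ex: "n < k * p ^ n" .
  define e where "e = (LEAST e. n < k * p ^ e)"
  have e: "n < k * p ^ e" unfolding e_def using ex by (rule LeastI)
  then obtain e' where e': "e = Suc e'" using assms(2) by (cases e) auto
  have "\<not> n < k * p ^ e'" using not_less_Least[of e' "\<lambda>e. n < k * p ^ e"] e' e_def by simp
  with that[of e'] e e' show thesis by simp
qed

section \<open>The bijection between generators and sifted integers\<close>

theorem theorem4:
  fixes n v :: nat
  assumes "n \<ge> 2"
    and "1 \<le> v" and "v \<le> prime_count (real n)"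
  shows "gens_count TYPE('k::field_char_0) n v = legendre_phi (real n) (real (nth_prime v))"
proof -
  define r where "r = prime_count (real n)"
  define W where "W = {a \<in> monomials r. weight a > n}"
  define G where "G = {a \<in> minimal_monomials r W. a \<noteq> 0 \<and> min_index a = v}"
  define L where "L = {m::nat. 1 \<le> m \<and> real m \<le> real n \<and>
    (\<forall>p. prime p \<and> p dvd m \<longrightarrow> real p > real (nth_prime v))}"
  let ?u = "Poly_Mapping.update v (0::nat)"
  have v: "1 \<le> v" "v \<le> r" using assms by (auto simp: r_def)
  have single_v: "Poly_Mapping.single v e \<in> monomials r" for e
    using v by (auto simp: monomials_def)
  have G_mon: "a \<in> monomials r" if "a \<in> G" for a
    using that by (auto simp: G_def minimal_monomials_def W_def)
  have u_mon: "?u a \<in> monomials r" if "a \<in> G" for a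
    using G_mon[OF that] by (auto simp: monomials_def keys_update_zero)
  have "bij_betw (\<lambda>a. weight (?u a)) G L"
    unfolding bij_betw_def
  proof (intro conjI equalityI subsetI)
    show "inj_on (\<lambda>a. weight (?u a)) G"
    proof (rule inj_onI)
      fix a b assume ab: "a \<in> G" "b \<in> G" "weight (?u a) = weight (?u b)"
      then have "?u a = ?u b" using inj_on_weight u_mon by (meson inj_onD)
      then show "a = b"
        using inj_on_update_minimal_monomials[OF v, of W] ab by (auto simp: G_def inj_on_def)
    qed
  next
    fix m assume "m \<in> (\<lambda>a. weight (?u a)) ` G"
    then obtain a where a: "a \<in> G" "m = weight (?u a)" by blast
    then have keys: "v \<in> Poly_Mapping.keys a" "Poly_Mapping.keys a \<subseteq> {v..}"
      using min_index_eq_iff[of a v] by (auto simp: G_def)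
    \<comment> \<open>The deleted power of \<open>x_v\<close> is a nontrivial cofactor, so
      \<open>?u a\<close> in \<open>W\<close> would contradict the minimality of
      \<open>a\<close>.\<close>
    have "Poly_Mapping.single v (Poly_Mapping.lookup a v) \<noteq> 0"
      using keys(1) by (metis in_keys_iff lookup_single_eq lookup_zero)
    then have "?u a \<notin> W"
      using a(1) update_zero_add_single[of v a] single_v unfolding G_def minimal_monomials_def
      by (smt (verit) mem_Collect_eq)
    then have "m \<le> n" using u_mon a by (auto simp: W_def)
    moreover have "nth_prime v < p" if p: "prime p" "p dvd m" for p
    proof -
      obtain i where i: "i \<in> Poly_Mapping.keys (?u a)" "p = nth_prime i"
        using prime_dvd_weight p a(2) by blast
      then have "v < i" using keys(2) by (auto simp: keys_update_zero)
      then show ?thesis using nth_prime_less v i by blast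
    qed
    moreover have "1 \<le> m" using weight_pos[of "?u a"] a by simp
    ultimately show "m \<in> L" by (auto simp: L_def)
  next
    fix m assume m: "m \<in> L"
    then have "\<exists>b\<in>monomials r. weight b = m"
      unfolding r_def by (intro ex_weight) (auto simp: L_def dest: dvd_imp_le)
    then obtain b where b: "b \<in> monomials r" "weight b = m" by blast
    obtain e where e: "m * nth_prime v ^ e \<le> n" "n < m * nth_prime v ^ Suc e"
      using minimal_exponent[of m n "nth_prime v"] m prime_gt_1_nat[OF prime_nth_prime]
      by (auto simp: L_def)
    have keys_b: "v < i" if "i \<in> Poly_Mapping.keys b" for i
    proof -
      \<comment> \<open>The prime of index \<open>i\<close> divides \<open>m\<close>, hence exceeds
        the prime of index \<open>v\<close>; monotonicity then excludes
        \<open>i \<le> v\<close>.\<close>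
      have "nth_prime v < nth_prime i" "1 \<le> i"
        using m b that nth_prime_dvd_weight[OF that] prime_nth_prime
        by (auto simp: L_def monomials_def)
      then show ?thesis using nth_prime_le[of i v] by (meson not_le)
    qed
    \<comment> \<open>The exponent is \<open>Suc e\<close>, the first that lifts the weight above
      \<open>n\<close>.\<close>
    define a where "a = b + Poly_Mapping.single v (Suc e)"
    have wa: "weight a = m * nth_prime v ^ Suc e"
      by (simp only: a_def weight_add weight_single b)
    have keys_a: "Poly_Mapping.keys a \<subseteq> {v..}"
      using keys_b Poly_Mapping.keys_add[of b "Poly_Mapping.single v (Suc e)"]
      by (auto simp: a_def less_imp_le)
    have v_a: "v \<in> Poly_Mapping.keys a"
      by (simp add: a_def in_keys_iff lookup_add)
    have aW: "a \<in> W"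
      using e wa monomials_add[OF b(1) single_v] by (auto simp: W_def a_def)
    have "c = 0" if bc: "b' \<in> W" "c \<in> monomials r" "a = b' + c" for b' c
    proof (rule ccontr)
      assume "c \<noteq> 0"
      then obtain i where i: "i \<in> Poly_Mapping.keys c" by fastforce
      then have "i \<in> Poly_Mapping.keys a"
        by (simp add: bc(3) in_keys_iff lookup_add)
      then have "nth_prime v \<le> nth_prime i"
        using keys_a v nth_prime_le by auto
      also have "\<dots> \<le> weight c"
        using nth_prime_dvd_weight[OF i] weight_pos by (rule dvd_imp_le)
      \<comment> \<open>A nontrivial cofactor weighs at least the prime of index \<open>v\<close>.
        As \<open>weight a\<close> is at most \<open>n\<close> times that prime, cancelling it
        leaves \<open>weight b' \<le> n\<close>.\<close>
      finally have "weight b' * nth_prime v \<le> weight b' * weight c" by simp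
      also have "\<dots> = (m * nth_prime v ^ e) * nth_prime v"
        using wa by (simp add: bc(3) weight_add)
      also have "\<dots> \<le> n * nth_prime v"
        using e(1) by (rule mult_right_mono) simp
      finally have "weight b' \<le> n"
        by simp
      then show False using bc(1) by (simp add: W_def)
    qed
    then have "a \<in> minimal_monomials r W"
      using aW by (auto simp: minimal_monomials_def)
    moreover have "a \<noteq> 0" using v_a by auto
    ultimately have "a \<in> G"
      using min_index_eq_iff[of a v] v_a keys_a by (auto simp: G_def)
    \<comment> \<open>Since \<open>b\<close> is free of \<open>x_v\<close>, deleting this variable
      from \<open>a\<close> gives back exactly \<open>b\<close>.\<close>
    moreover have "Poly_Mapping.lookup b v = 0"
      using keys_b by (metis in_keys_iff less_irrefl)
    then have "?u a = b"
      by (intro poly_mapping_eqI) (auto simp: a_def lookup_update lookup_add lookup_single)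
    ultimately show "m \<in> (\<lambda>a. weight (?u a)) ` G"
      using b(2) by (metis imageI)
  qed
  then have "card G = card L" by (rule bij_betw_same_card)
  then show ?thesis
    unfolding gens_count_def legendre_phi_def min_mon_gens_weight_ideal
    by (simp add: G_def L_def W_def r_def)
qed

end
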